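(* Let $G$ be a countable infinite discrete amenable group acting continuously on a compact metric space $(X,d)$, and let $\{F_n\}_{n=1}^{\infty}$ be a Følner sequence in $G$ with $|F_n|$ increasing and $|F_n|\to\infty$. Let $H\subset X$ be a non-empty subset. For any positive continuous function $\Phi:X\to\mathbb{R}$, we have $\dim_H^{\widetilde{BSP}}(\{F_n\}_{n=1}^{\infty},\Phi)=t$, where $t$ is the unique root of the equation $P_H^P(\{F_n\}_{n=1}^{\infty},-t\Phi)=0$.
   Context: A Følner sequence in $G$ is a sequence of non-empty finite subsets $F_n\subset G$ with $\lim_{n\to\infty}|F_n\triangle gF_n|/|F_n|=0$ for every $g\in G$. For finite $F\subset G$ and continuous $\Psi:X\to\mathbb{R}$: $d_F(x,y)=\max_{g\in F}d(gx,gy)$, $\overline B_F(x,\epsilon)=\{y:d_F(x,y)\le\epsilon\}$, and $\Psi_F(x)=\sum_{g\in F}\Psi(gx)$. BS packing dimension of a set (here $s>0$, $\sup\emptyset=0$, $\inf\emptyset=\infty$). For $H\subset X$, $\epsilon>0$, $N\in\mathbb{N}$ let $$L^{s}_{N,\epsilon}(H,\{F_n\},\Phi)=\sup\sum_{i\in I}\exp\Big(-s\sup_{y\in\overline B_{F_{n_i}}(x_i,\epsilon)}\Phi_{F_{n_i}}(y)\Big),$$ the supremum over all finite or countable pairwise disjoint families $\{\overline B_{F_{n_i}}(x_i,\epsilon)\}_{i\in I}$ with $n_i\ge N$, $x_i\in H$. Let $L^s_\epsilon(H,\{F_n\},\Phi)=\lim_{N\to\infty}L^s_{N,\epsilon}(H,\{F_n\},\Phi)$,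 $\mathscr L^s_\epsilon(H,\{F_n\},\Phi)=\inf\{\sum_{i=1}^\infty L^s_\epsilon(H_i,\{F_n\},\Phi):H\subset\bigcup_{i=1}^\infty H_i\}$, $\mathscr L_\epsilon(H,\{F_n\},\Phi)=\sup\{s:\mathscr L^s_\epsilon=\infty\}=\inf\{s:\mathscr L^s_\epsilon=0\}$, and $\dim_H^{\widetilde{BSP}}(\{F_n\},\Phi)=\lim_{\epsilon\to0}\mathscr L_\epsilon(H,\{F_n\},\Phi)$. Packing topological pressure (here $s\in\mathbb{R}$). For continuous $\Psi:X\to\mathbb{R}$ let $$M^P(N,s,\epsilon,H,\{F_n\},\Psi)=\sup\sum_{i\in I}e^{-s|F_{n_i}|+\Psi_{F_{n_i}}(x_i)},$$ the supremum over all finite or countable pairwise disjoint families $\{\overline B_{F_{n_i}}(x_i,\epsilon)\}_{i\in I}$ with $n_i\ge N$, $x_i\in H$; let $M^P(s,\epsilon,H,\{F_n\},\Psi)=\lim_{N\to\infty}M^P(N,s,\epsilon,H,\{F_n\},\Psi)$, $M^{\mathcal P}(s,\epsilon,H,\{F_n\},\Psi)=\inf\{\sum_{i=1}^\infty M^P(s,\epsilon,H_i,\{F_n\},\Psi):H\subset\bigcup_{i=1}^\infty H_i\}$, $P^P(\epsilon,H,\{F_n\},\Psi)=\sup\{s:M^{\mathcal P}(s,\epsilon,H,\{F_n\},\Psi)=\infty\}=\inf\{s:M^{\mathcal P}(s,\epsilon,H,\{F_n\},\Psi)=0\}$, and $P_H^P(\{F_n\},\Psi)=\lim_{\epsilo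n\to0}P^P(\epsilon,H,\{F_n\},\Psi)$.
   Formalization: Existence of the root t is claimed only when the packing pressure P_H^P({F_n},0) is finite; if it is infinite (e.g. the full shift on [0,1]^Z with H = X), P_H^P({F_n},-tΦ) is infinite for every real t and no root exists. *)

theory Defs
  imports "HOL-Analysis.Analysis" "HOL-Algebra.Group_Action"
begin

text \<open>
  The compact metric space is a type of class \<open>metric_space\<close>; the action of \<open>G\<close> is a
  homomorphism \<open>\<phi>\<close> from \<open>G\<close> into the bijections of that type, so \<open>\<phi> g x\<close> is \<open>g x\<close>.  Sequences
  of finite sets are indexed from \<open>0\<close> instead of \<open>1\<close>.
\<close>

definition folner_sequence :: "('g, 'b) monoid_scheme \<Rightarrow> (nat \<Rightarrow> 'g set) \<Rightarrow> bool" where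
  "folner_sequence G F \<longleftrightarrow>
     (\<forall>n. finite (F n) \<and> F n \<noteq> {} \<and> F n \<subseteq> carrier G) \<and>
     (\<forall>g\<in>carrier G.
        (\<lambda>n. real (card ((F n - (g <#\<^bsub>G\<^esub> F n)) \<union> ((g <#\<^bsub>G\<^esub> F n) - F n))) / real (card (F n)))
          \<longlonglongrightarrow> 0)"

text \<open>Amenability of a countable discrete group, as existence of a Folner sequence.\<close>

definition amenable_group :: "('g, 'b) monoid_scheme \<Rightarrow> bool" where
  "amenable_group G \<longleftrightarrow> group G \<and> countable (carrier G) \<and> (\<exists>F. folner_sequence G F)"

definition continuous_action ::
  "('g, 'b) monoid_scheme \<Rightarrow> ('g \<Rightarrow> 'x::topological_space \<Rightarrow> 'x) \<Rightarrow> bool" where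
  "continuous_action G \<phi> \<longleftrightarrow>
     group_action G UNIV \<phi> \<and> (\<forall>g\<in>carrier G. continuous_on UNIV (\<phi> g))"

text \<open>The metric \<open>d\<^sub>F\<close>, used only for finite non-empty \<open>F\<close>.\<close>

definition bowen_dist :: "('g \<Rightarrow> 'x::metric_space \<Rightarrow> 'x) \<Rightarrow> 'g set \<Rightarrow> 'x \<Rightarrow> 'x \<Rightarrow> real" where
  "bowen_dist \<phi> F x y = (MAX g\<in>F. dist (\<phi> g x) (\<phi> g y))"

definition bowen_cball :: "('g \<Rightarrow> 'x::metric_space \<Rightarrow> 'x) \<Rightarrow> 'g set \<Rightarrow> 'x \<Rightarrow> real \<Rightarrow> 'x set" where
  "bowen_cball \<phi> F x \<epsilon> = {y. bowen_dist \<phi> F x y \<le> \<epsilon>}"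

definition birkhoff_sum :: "('g \<Rightarrow> 'x \<Rightarrow> 'x) \<Rightarrow> 'g set \<Rightarrow> ('x \<Rightarrow> real) \<Rightarrow> 'x \<Rightarrow> real" where
  "birkhoff_sum \<phi> F \<Psi> x = (\<Sum>g\<in>F. \<Psi> (\<phi> g x))"

text \<open>
  The finite or countable pairwise disjoint families of closed Bowen balls centred in \<open>H\<close> with
  levels at least \<open>N\<close>.  A family is given by an index set \<open>I\<close>, the centres \<open>x i\<close> and the levels
  \<open>n i\<close>; taking \<open>I\<close> to be a set of natural numbers covers all countable index sets.
\<close>

definition packings ::
  "('g \<Rightarrow> 'x::metric_space \<Rightarrow> 'x) \<Rightarrow> (nat \<Rightarrow> 'g set) \<Rightarrow> nat \<Rightarrow> real \<Rightarrow> 'x set \<Rightarrow>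
     (nat set \<times> (nat \<Rightarrow> 'x) \<times> (nat \<Rightarrow> nat)) set" where
  "packings \<phi> F N \<epsilon> H =
     {(I, x, n). (\<forall>i\<in>I. N \<le> n i \<and> x i \<in> H) \<and>
                 disjoint_family_on (\<lambda>i. bowen_cball \<phi> (F (n i)) (x i) \<epsilon>) I}"

text \<open>
  The passage from a set function \<open>L\<close> to its countable-cover version, common to both
  constructions below.
\<close>

definition countable_cover_inf :: "('x set \<Rightarrow> ennreal) \<Rightarrow> 'x set \<Rightarrow> ennreal" where
  "countable_cover_inf L H = (INF Hs\<in>{Hs :: nat \<Rightarrow> 'x set. H \<subseteq> (\<Union>i. Hs i)}. \<Sum>i. L (Hs i))"


subsection \<open>BS packing dimension\<close>

definition bsp_level ::
  "('g \<Rightarrow> 'x::metric_space \<Rightarrow> 'x) \<Rightarrow> (nat \<Rightarrow> 'g set) \<Rightarrow> ('x \<Rightarrow> real) \<Rightarrow> real \<Rightarrow> real \<Rightarrow> nat \<Rightarrow>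
     'x set \<Rightarrow> ennreal" where
  "bsp_level \<phi> F \<Phi> s \<epsilon> N H =
     (SUP (I, x, n)\<in>packings \<phi> F N \<epsilon> H.
        \<Sum>\<^sub>\<infinity>i\<in>I. ennreal (exp (- s *
          (SUP y\<in>bowen_cball \<phi> (F (n i)) (x i) \<epsilon>. birkhoff_sum \<phi> (F (n i)) \<Phi> y))))"

definition bsp_premeasure ::
  "('g \<Rightarrow> 'x::metric_space \<Rightarrow> 'x) \<Rightarrow> (nat \<Rightarrow> 'g set) \<Rightarrow> ('x \<Rightarrow> real) \<Rightarrow> real \<Rightarrow> real \<Rightarrow>
     'x set \<Rightarrow> ennreal" where
  "bsp_premeasure \<phi> F \<Phi> s \<epsilon> H = lim (\<lambda>N. bsp_level \<phi> F \<Phi> s \<epsilon> N H)"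

definition bsp_measure ::
  "('g \<Rightarrow> 'x::metric_space \<Rightarrow> 'x) \<Rightarrow> (nat \<Rightarrow> 'g set) \<Rightarrow> ('x \<Rightarrow> real) \<Rightarrow> real \<Rightarrow> real \<Rightarrow>
     'x set \<Rightarrow> ennreal" where
  "bsp_measure \<phi> F \<Phi> s \<epsilon> = countable_cover_inf (bsp_premeasure \<phi> F \<Phi> s \<epsilon>)"

text \<open>
  Only \<open>s > 0\<close> is considered and the supremum is taken in \<open>[0, \<infinity>]\<close>, so that the supremum of
  the empty set is \<open>0\<close>.  For \<open>\<Phi> > 0\<close> and \<open>|F\<^sub>n| \<rightarrow> \<infinity>\<close> this critical value is also the infimum of
  the \<open>s > 0\<close> at which the measure vanishes.
\<close>

definition bsp_dim_at ::
  "('g \<Rightarrow> 'x::metric_space \<Rightarrow> 'x) \<Rightarrow> (nat \<Rightarrow> 'g set) \<Rightarrow> ('x \<Rightarrow> real) \<Rightarrow> real \<Rightarrow> 'x set \<Rightarrow> ennreal" where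
  "bsp_dim_at \<phi> F \<Phi> \<epsilon> H = (SUP s\<in>{s. 0 < s \<and> bsp_measure \<phi> F \<Phi> s \<epsilon> H = \<infinity>}. ennreal s)"

definition bsp_dim ::
  "('g \<Rightarrow> 'x::metric_space \<Rightarrow> 'x) \<Rightarrow> (nat \<Rightarrow> 'g set) \<Rightarrow> ('x \<Rightarrow> real) \<Rightarrow> 'x set \<Rightarrow> ennreal" where
  "bsp_dim \<phi> F \<Phi> H = Lim (at_right 0) (\<lambda>\<epsilon>. bsp_dim_at \<phi> F \<Phi> \<epsilon> H)"


subsection \<open>Packing topological pressure\<close>

definition pressure_level ::
  "('g \<Rightarrow> 'x::metric_space \<Rightarrow> 'x) \<Rightarrow> (nat \<Rightarrow> 'g set) \<Rightarrow> ('x \<Rightarrow> real) \<Rightarrow> real \<Rightarrow> real \<Rightarrow> nat \<Rightarrow>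
     'x set \<Rightarrow> ennreal" where
  "pressure_level \<phi> F \<Psi> s \<epsilon> N H =
     (SUP (I, x, n)\<in>packings \<phi> F N \<epsilon> H.
        \<Sum>\<^sub>\<infinity>i\<in>I. ennreal (exp (- s * real (card (F (n i))) + birkhoff_sum \<phi> (F (n i)) \<Psi> (x i))))"

definition pressure_premeasure ::
  "('g \<Rightarrow> 'x::metric_space \<Rightarrow> 'x) \<Rightarrow> (nat \<Rightarrow> 'g set) \<Rightarrow> ('x \<Rightarrow> real) \<Rightarrow> real \<Rightarrow> real \<Rightarrow>
     'x set \<Rightarrow> ennreal" where
  "pressure_premeasure \<phi> F \<Psi> s \<epsilon> H = lim (\<lambda>N. pressure_level \<phi> F \<Psi> s \<epsilon> N H)"

definition pressure_measure ::
  "('g \<Rightarrow> 'x::metric_space \<Rightarrow> 'x) \<Rightarrow> (nat \<Rightarrow> 'g set) \<Rightarrow> ('x \<Rightarrow> real) \<Rightarrow> real \<Rightarrow> real \<Rightarrow>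
     'x set \<Rightarrow> ennreal" where
  "pressure_measure \<phi> F \<Psi> s \<epsilon> = countable_cover_inf (pressure_premeasure \<phi> F \<Psi> s \<epsilon>)"

text \<open>
  Here \<open>s\<close> ranges over all reals and the supremum is taken in \<open>[-\<infinity>, \<infinity>]\<close>.  For \<open>|F\<^sub>n| \<rightarrow> \<infinity>\<close> it is
  also the infimum of the \<open>s\<close> at which the measure vanishes.
\<close>

definition packing_pressure_at ::
  "('g \<Rightarrow> 'x::metric_space \<Rightarrow> 'x) \<Rightarrow> (nat \<Rightarrow> 'g set) \<Rightarrow> ('x \<Rightarrow> real) \<Rightarrow> real \<Rightarrow> 'x set \<Rightarrow> ereal" where
  "packing_pressure_at \<phi> F \<Psi> \<epsilon> H = (SUP s\<in>{s. pressure_measure \<phi> F \<Psi> s \<epsilon> H = \<infinity>}. ereal s)"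

definition packing_pressure ::
  "('g \<Rightarrow> 'x::metric_space \<Rightarrow> 'x) \<Rightarrow> (nat \<Rightarrow> 'g set) \<Rightarrow> ('x \<Rightarrow> real) \<Rightarrow> 'x set \<Rightarrow> ereal" where
  "packing_pressure \<phi> F \<Psi> H = Lim (at_right 0) (\<lambda>\<epsilon>. packing_pressure_at \<phi> F \<Psi> \<epsilon> H)"

end

theory Submission
  imports Defs
begin

text \<open>
  Write \<open>P t\<close> for the packing pressure of \<open>- t * \<Phi>\<close>, and let \<open>0 < m \<le> \<Phi> \<le> M\<close>, which compactness
  provides.  Raising the potential by a constant \<open>c\<close> is the same as lowering the exponent \<open>s\<close> by
  \<open>c\<close>, so \<open>P\<close> decreases at a rate between \<open>m\<close> and \<open>M\<close> (lemma
  \<open>packing_pressure_le_add_const\<close>).  Hence \<open>P\<close> has at most one zero, and if \<open>P 0\<close> is finite the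
  intermediate value theorem gives one; \<open>P 0 \<ge> 0\<close> because a single ball around a
  point of \<open>H\<close> already makes the measure infinite for every negative exponent.

  The zero is the BS packing dimension because the two weights attached to a Bowen ball around
  \<open>x\<close> nearly agree.  The supremum of \<open>\<Phi>\<^sub>F\<close> over the ball of radius \<open>\<epsilon>\<close> lies between \<open>\<Phi>\<^sub>F x\<close> and
  \<open>\<Phi>\<^sub>F x + \<delta> |F|\<close>, where \<open>\<delta>\<close> becomes small with \<open>\<epsilon>\<close> by uniform continuity.  The BS measure with
  parameter \<open>s\<close> is therefore at most the pressure measure of \<open>- s * \<Phi>\<close> with exponent \<open>0\<close> and at
  least the one with exponent \<open>s * \<delta>\<close>.  If the BS measure is infinite, then \<open>P s \<ge> 0\<close>, so \<open>s\<close> is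
  at most the zero \<open>t\<close>; and if \<open>0 < s < t\<close>, then \<open>P s > 0\<close>, so a small \<open>\<delta>\<close> makes the lower bound
  infinite.

  Every comparison of measures is an instance of one monotonicity statement
  (\<open>weighted_packing_measure_mono\<close>).
\<close>

section \<open>Packing measures with general weights\<close>

text \<open>
  The common form of both measures: \<open>w k x\<close> is the weight of the Bowen ball of level \<open>k\<close> around \<open>x\<close>.
\<close>

definition weighted_packing_level ::
  "('g \<Rightarrow> 'x::metric_space \<Rightarrow> 'x) \<Rightarrow> (nat \<Rightarrow> 'g set) \<Rightarrow> (nat \<Rightarrow> 'x \<Rightarrow> real) \<Rightarrow> real \<Rightarrow> nat \<Rightarrow>
     'x set \<Rightarrow> ennreal" where
  "weighted_packing_level \<phi> F w \<epsilon> N H =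
     (SUP (I, x, n)\<in>packings \<phi> F N \<epsilon> H. \<Sum>\<^sub>\<infinity>i\<in>I. ennreal (w (n i) (x i)))"

definition weighted_packing_measure ::
  "('g \<Rightarrow> 'x::metric_space \<Rightarrow> 'x) \<Rightarrow> (nat \<Rightarrow> 'g set) \<Rightarrow> (nat \<Rightarrow> 'x \<Rightarrow> real) \<Rightarrow> real \<Rightarrow> 'x set \<Rightarrow>
     ennreal" where
  "weighted_packing_measure \<phi> F w \<epsilon> =
     countable_cover_inf (\<lambda>H. lim (\<lambda>N. weighted_packing_level \<phi> F w \<epsilon> N H))"

lemma pressure_measure_eq_weighted:
  "pressure_measure \<phi> F \<Psi> s \<epsilon> =
     weighted_packing_measure \<phi> F
       (\<lambda>k x. exp (- s * real (card (F k)) + birkhoff_sum \<phi> (F k) \<Psi> x)) \<epsilon>"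
  unfolding pressure_measure_def pressure_premeasure_def pressure_level_def
    weighted_packing_measure_def weighted_packing_level_def ..

lemma bsp_measure_eq_weighted:
  "bsp_measure \<phi> F \<Phi> s \<epsilon> =
     weighted_packing_measure \<phi> F
       (\<lambda>k x. exp (- s * (SUP y\<in>bowen_cball \<phi> (F k) x \<epsilon>. birkhoff_sum \<phi> (F k) \<Phi> y))) \<epsilon>"
  unfolding bsp_measure_def bsp_premeasure_def bsp_level_def
    weighted_packing_measure_def weighted_packing_level_def ..

lemma bowen_cball_mono_radius: "\<epsilon>' \<le> \<epsilon> \<Longrightarrow> bowen_cball \<phi> F x \<epsilon>' \<subseteq> bowen_cball \<phi> F x \<epsilon>"
  by (auto simp: bowen_cball_def)

lemma packings_mono:
  assumes "M \<le> N" "\<epsilon>' \<le> \<epsilon>"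
  shows "packings \<phi> F N \<epsilon> H \<subseteq> packings \<phi> F M \<epsilon>' H"
proof -
  have "disjoint_family_on (\<lambda>i. bowen_cball \<phi> (F (n i)) (x i) \<epsilon>') I"
    if "disjoint_family_on (\<lambda>i. bowen_cball \<phi> (F (n i)) (x i) \<epsilon>) I" for x n I
    using that bowen_cball_mono_radius[OF assms(2), of \<phi>]
    unfolding disjoint_family_on_def by blast
  then show ?thesis
    using assms(1) unfolding packings_def by (auto intro: le_trans)
qed

lemma weighted_packing_level_mono:
  assumes "M \<le> N" "\<epsilon>' \<le> \<epsilon>" "\<And>k x. w k x \<le> w' k x"
  shows "weighted_packing_level \<phi> F w \<epsilon> N H \<le> weighted_packing_level \<phi> F w' \<epsilon>' M H"
  unfolding weighted_packing_level_def
proof (rule SUP_mono, safe)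
  fix I x n assume "(I, x, n) \<in> packings \<phi> F N \<epsilon> H"
  then have "(I, x, n) \<in> packings \<phi> F M \<epsilon>' H"
    using packings_mono[OF assms(1,2)] by blast
  moreover have "(\<Sum>\<^sub>\<infinity>i\<in>I. ennreal (w (n i) (x i))) \<le> (\<Sum>\<^sub>\<infinity>i\<in>I. ennreal (w' (n i) (x i)))"
    by (intro infsum_mono nonneg_summable_on_complete ennreal_leI assms) auto
  ultimately show "\<exists>q\<in>packings \<phi> F M \<epsilon>' H. (\<Sum>\<^sub>\<infinity>i\<in>I. ennreal (w (n i) (x i)))
      \<le> (case q of (I, x, n) \<Rightarrow> \<Sum>\<^sub>\<infinity>i\<in>I. ennreal (w' (n i) (x i)))"
    by (intro bexI[of _ "(I, x, n)"]) auto
qed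

lemma lim_weighted_packing_level:
  "lim (\<lambda>N. weighted_packing_level \<phi> F w \<epsilon> N H) = (INF N. weighted_packing_level \<phi> F w \<epsilon> N H)"
  by (intro limI LIMSEQ_INF antimonoI weighted_packing_level_mono) auto

text \<open>
  Balls of smaller radius stay disjoint, so shrinking the radius enlarges the supply of packings;
  the covers over which the infimum runs do not depend on radius or weight.
\<close>

lemma weighted_packing_measure_mono:
  assumes "\<epsilon>' \<le> \<epsilon>" "\<And>k x. w k x \<le> w' k x"
  shows "weighted_packing_measure \<phi> F w \<epsilon> H \<le> weighted_packing_measure \<phi> F w' \<epsilon>' H"
proof -
  have "(INF N. weighted_packing_level \<phi> F w \<epsilon> N A) \<le> (INF N. weighted_packing_level \<phi> F w' \<epsilon>' N A)"
    for A
    by (rule INF_mono', rule weighted_packing_level_mono) (simp_all add: assms)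
  then show ?thesis
    unfolding weighted_packing_measure_def countable_cover_inf_def lim_weighted_packing_level
    by (intro INF_mono'[OF suminf_le] summableI)
qed

text \<open>
  Any countable cover of \<open>H\<close> has a member that contains a point, and packings by one ball
  around this point, at higher and higher levels, have unbounded weight.
\<close>

lemma weighted_packing_measure_eq_top:
  assumes "H \<noteq> {}" "\<And>x. filterlim (\<lambda>k. w k x) at_top sequentially"
  shows "weighted_packing_measure \<phi> F w \<epsilon> H = \<infinity>"
proof -
  have level: "weighted_packing_level \<phi> F w \<epsilon> N A = \<infinity>" if "a \<in> A" for a A N
  proof -
    have "ennreal r \<le> weighted_packing_level \<phi> F w \<epsilon> N A" for r
    proof -
      have "eventually (\<lambda>k. r \<le> w k a \<and> N \<le> k) sequentially"
        using assms(2)[of a] unfolding filterlim_at_top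
        by (intro eventually_conj eventually_ge_at_top) auto
      then obtain k where k: "r \<le> w k a" "N \<le> k"
        by (auto dest: eventually_happens'[OF sequentially_bot])
      have "({0}, \<lambda>_. a, \<lambda>_. k) \<in> packings \<phi> F N \<epsilon> A"
        using that k by (auto simp: packings_def disjoint_family_on_def)
      then have "(\<Sum>\<^sub>\<infinity>i\<in>{0::nat}. ennreal (w k a)) \<le> weighted_packing_level \<phi> F w \<epsilon> N A"
        unfolding weighted_packing_level_def by (rule SUP_upper2) simp
      then have "ennreal (w k a) \<le> weighted_packing_level \<phi> F w \<epsilon> N A"
        by simp
      with k show ?thesis
        using ennreal_leI order_trans by blast
    qed
    then show ?thesis
      by (metis ennreal_Ex_less_of_nat ennreal_of_nat_eq_real_of_nat infinity_ennreal_def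
          linorder_not_le top.not_eq_extremum)
  qed
  have "(\<Sum>i. INF N. weighted_packing_level \<phi> F w \<epsilon> N (Hs i)) = \<infinity>" if cover: "H \<subseteq> (\<Union>i. Hs i)" for Hs
  proof -
    obtain a i where "a \<in> Hs i"
      using assms(1) cover by blast
    then have "(INF N. weighted_packing_level \<phi> F w \<epsilon> N (Hs i)) = \<infinity>"
      by (simp add: level)
    then show ?thesis
      using sum_le_suminf[of "\<lambda>i. INF N. weighted_packing_level \<phi> F w \<epsilon> N (Hs i)" "{i}"]
      by (simp add: top_unique)
  qed
  then show ?thesis
    unfolding weighted_packing_measure_def countable_cover_inf_def lim_weighted_packing_level
    by (simp add: INF_eqI)
qed


section \<open>Limits as the radius shrinks\<close>

lemma Lim_at_right_eq_SUP:
  fixes f :: "real \<Rightarrow> 'a::{complete_linorder, linorder_topology}"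
  assumes "\<And>a b. 0 < a \<Longrightarrow> a \<le> b \<Longrightarrow> f b \<le> f a"
  shows "Lim (at_right 0) f = (SUP \<epsilon>\<in>{0<..}. f \<epsilon>)"
proof (rule tendsto_Lim)
  show "(f \<longlongrightarrow> (SUP \<epsilon>\<in>{0<..}. f \<epsilon>)) (at_right 0)"
  proof (rule order_tendstoI)
    fix y assume "y < (SUP \<epsilon>\<in>{0<..}. f \<epsilon>)"
    then obtain \<epsilon> where \<epsilon>: "0 < \<epsilon>" "y < f \<epsilon>"
      by (auto simp: less_SUP_iff)
    then show "eventually (\<lambda>\<epsilon>. y < f \<epsilon>) (at_right 0)"
      unfolding eventually_at_right_field
      using assms by (intro exI[of _ \<epsilon>]) (auto intro: less_le_trans)
  next
    fix y assume y: "(SUP \<epsilon>\<in>{0<..}. f \<epsilon>) < y"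
    show "eventually (\<lambda>\<epsilon>. f \<epsilon> < y) (at_right 0)"
      unfolding eventually_at_right_field
      by (intro exI[of _ 1]) (auto intro: le_less_trans[OF SUP_upper y])
  qed
qed simp

lemma packing_pressure_at_antimono:
  assumes "\<epsilon>' \<le> \<epsilon>"
  shows "packing_pressure_at \<phi> F \<Psi> \<epsilon> H \<le> packing_pressure_at \<phi> F \<Psi> \<epsilon>' H"
proof -
  have "pressure_measure \<phi> F \<Psi> s \<epsilon> H \<le> pressure_measure \<phi> F \<Psi> s \<epsilon>' H" for s
    unfolding pressure_measure_eq_weighted
    by (intro weighted_packing_measure_mono assms order_refl)
  then show ?thesis
    unfolding packing_pressure_at_def
    by (intro SUP_subset_mono) (auto simp: top_unique, metis top_unique)
qed

lemma packing_pressure_eq_SUP: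
  "packing_pressure \<phi> F \<Psi> H = (SUP \<epsilon>\<in>{0<..}. packing_pressure_at \<phi> F \<Psi> \<epsilon> H)"
  unfolding packing_pressure_def by (intro Lim_at_right_eq_SUP packing_pressure_at_antimono)


section \<open>Dependence of the pressure on the potential\<close>

lemma birkhoff_sum_le_add_const:
  assumes "\<And>g. g \<in> F \<Longrightarrow> \<Psi> (\<phi> g x) \<le> \<Psi>' (\<phi> g y) + c"
  shows "birkhoff_sum \<phi> F \<Psi> x \<le> birkhoff_sum \<phi> F \<Psi>' y + c * real (card F)"
proof -
  have "birkhoff_sum \<phi> F \<Psi> x \<le> (\<Sum>g\<in>F. \<Psi>' (\<phi> g y) + c)"
    unfolding birkhoff_sum_def by (rule sum_mono) (rule assms)
  then show ?thesis
    by (simp add: birkhoff_sum_def sum.distrib mult.commute)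
qed

text \<open>
  Adding \<open>c\<close> to the potential multiplies the weight of a ball of level \<open>k\<close> by \<open>exp (c * |F k|)\<close>, and
  so does subtracting \<open>c\<close> from the exponent.
\<close>

lemma pressure_measure_le_shift:
  assumes "\<And>x. \<Psi> x \<le> \<Psi>' x + c" "s' + c \<le> s"
  shows "pressure_measure \<phi> F \<Psi> s \<epsilon> H \<le> pressure_measure \<phi> F \<Psi>' s' \<epsilon> H"
  unfolding pressure_measure_eq_weighted
proof (rule weighted_packing_measure_mono)
  fix k x
  have "(s' + c) * real (card (F k)) \<le> s * real (card (F k))"
    using assms(2) by (intro mult_right_mono) auto
  moreover have "birkhoff_sum \<phi> (F k) \<Psi> x \<le> birkhoff_sum \<phi> (F k) \<Psi>' x + c * real (card (F k))"
    by (intro birkhoff_sum_le_add_const assms)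
  ultimately show "exp (- s * real (card (F k)) + birkhoff_sum \<phi> (F k) \<Psi> x)
      \<le> exp (- s' * real (card (F k)) + birkhoff_sum \<phi> (F k) \<Psi>' x)"
    by (simp add: algebra_simps)
qed simp

lemma packing_pressure_le_add_const:
  assumes "\<And>x. \<Psi> x \<le> \<Psi>' x + c"
  shows "packing_pressure \<phi> F \<Psi> H \<le> packing_pressure \<phi> F \<Psi>' H + ereal c"
  unfolding packing_pressure_eq_SUP[of \<phi> F \<Psi>]
proof (rule SUP_least)
  fix \<epsilon> :: real assume \<epsilon>: "\<epsilon> \<in> {0<..}"
  show "packing_pressure_at \<phi> F \<Psi> \<epsilon> H \<le> packing_pressure \<phi> F \<Psi>' H + ereal c"
    unfolding packing_pressure_at_def[of \<phi> F \<Psi>]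
  proof (rule SUP_least)
    fix s assume "s \<in> {s. pressure_measure \<phi> F \<Psi> s \<epsilon> H = \<infinity>}"
    then have "pressure_measure \<phi> F \<Psi>' (s - c) \<epsilon> H = \<infinity>"
      using pressure_measure_le_shift[where \<Psi>=\<Psi> and \<Psi>'=\<Psi>' and c=c, OF assms,
          where s=s and s'="s - c" and \<phi>=\<phi> and F=F and \<epsilon>=\<epsilon> and H=H]
      by (simp add: top_unique)
    then have "ereal (s - c) \<le> packing_pressure_at \<phi> F \<Psi>' \<epsilon> H"
      unfolding packing_pressure_at_def by (intro SUP_upper) simp
    also have "\<dots> \<le> packing_pressure \<phi> F \<Psi>' H"
      unfolding packing_pressure_eq_SUP by (rule SUP_upper[OF \<epsilon>])
    finally have "ereal (s - c) + ereal c \<le> packing_pressure \<phi> F \<Psi>' H + ereal c"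
      by (rule add_right_mono)
    then show "ereal s \<le> packing_pressure \<phi> F \<Psi>' H + ereal c"
      by simp
  qed
qed

lemma packing_pressure_zero_nonneg:
  assumes "filterlim (\<lambda>n. card (F n)) at_top sequentially" "H \<noteq> {}"
  shows "0 \<le> packing_pressure \<phi> F (\<lambda>_. 0) H"
proof (rule ereal_le_epsilon2)
  fix e :: real assume "0 < e"
  have "filterlim (\<lambda>k. exp (e * real (card (F k)))) at_top sequentially"
    using assms(1) \<open>0 < e\<close>
    by (intro filterlim_compose[OF exp_at_top] filterlim_tendsto_pos_mult_at_top[OF tendsto_const]
          filterlim_compose[OF filterlim_real_sequentially])
  then have "pressure_measure \<phi> F (\<lambda>_. 0) (- e) 1 H = \<infinity>"
    unfolding pressure_measure_eq_weighted
    by (intro weighted_packing_measure_eq_top assms(2)) (simp add: birkhoff_sum_def)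
  then have "ereal (- e) \<le> packing_pressure_at \<phi> F (\<lambda>_. 0) 1 H"
    unfolding packing_pressure_at_def by (intro SUP_upper) simp
  also have "\<dots> \<le> packing_pressure \<phi> F (\<lambda>_. 0) H"
    unfolding packing_pressure_eq_SUP by (rule SUP_upper) simp
  finally have "ereal (- e) + ereal e \<le> packing_pressure \<phi> F (\<lambda>_. 0) H + ereal e"
    by (rule add_right_mono)
  then show "0 \<le> packing_pressure \<phi> F (\<lambda>_. 0) H + ereal e"
    by (simp add: zero_ereal_def)
qed


section \<open>Zeros of functions with slope between two negative bounds\<close>

lemma bounded_slope_root_unique:
  fixes f :: "real \<Rightarrow> ereal"
  assumes "\<And>t t'. t \<le> t' \<Longrightarrow> f t' \<le> f t + ereal (- (t' - t) * m)" "0 < m" "f t = 0" "f t' = 0"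
  shows "t' = t"
proof -
  have "a = b" if "a \<le> b" "f a = 0" "f b = 0" for a b
    using assms(1)[OF that(1)] that assms(2)
    by (auto simp: zero_ereal_def mult_le_0_iff zero_le_mult_iff)
  then show ?thesis
    using assms(3,4) by (metis linear)
qed

text \<open>
  On \<open>[0, \<infinity>)\<close> the two slope bounds make \<open>f\<close> real-valued and Lipschitz, and by the upper one \<open>f\<close> has
  dropped to \<open>0\<close> or below by the time \<open>f 0 / m\<close>.
\<close>

lemma bounded_slope_root_exists:
  fixes f :: "real \<Rightarrow> ereal"
  assumes upper: "\<And>t t'. t \<le> t' \<Longrightarrow> f t' \<le> f t + ereal (- (t' - t) * m)" and "0 < m"
    and lower: "\<And>t t'. t \<le> t' \<Longrightarrow> f t \<le> f t' + ereal ((t' - t) * M)"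
    and "0 \<le> f 0" "f 0 < \<infinity>"
  shows "\<exists>t. f t = 0"
proof -
  obtain p where p: "f 0 = ereal p"
    using assms(4,5) by (cases "f 0") auto
  define r where "r t = real_of_ereal (f t)" for t
  have fin: "f t = ereal (r t)" if "0 \<le> t" for t
    using upper[OF that] lower[OF that] p by (cases "f t") (auto simp: r_def)
  have r_upper: "r t' \<le> r t - (t' - t) * m" if "0 \<le> t" "t \<le> t'" for t t'
    using upper[OF that(2)] fin[of t] fin[of t'] that by (simp add: algebra_simps)
  have r_lower: "r t \<le> r t' + (t' - t) * M" if "0 \<le> t" "t \<le> t'" for t t'
    using lower[OF that(2)] fin[of t] fin[of t'] that by (simp add: algebra_simps)
  have lip: "\<bar>r t' - r t\<bar> \<le> \<bar>M\<bar> * \<bar>t' - t\<bar>" if "0 \<le> t" "t \<le> t'" for t t'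
  proof -
    have "0 \<le> (t' - t) * m" "(t' - t) * M \<le> \<bar>M\<bar> * \<bar>t' - t\<bar>"
      using that \<open>0 < m\<close> by (auto simp: mult.commute[of "\<bar>M\<bar>"] intro!: mult_left_mono)
    then show ?thesis
      using r_upper[OF that] r_lower[OF that] by linarith
  qed
  have "\<bar>M\<bar>-lipschitz_on {0..} r"
  proof (rule lipschitz_onI)
    fix t t' :: real assume "t \<in> {0..}" "t' \<in> {0..}"
    then show "dist (r t) (r t') \<le> \<bar>M\<bar> * dist t t'"
      using lip[of t t'] lip[of t' t] by (cases "t \<le> t'") (auto simp: dist_real_def abs_minus_commute)
  qed simp
  then have "continuous_on {0..p / m} r"
    by (intro continuous_on_subset[OF lipschitz_on_continuous_on]) auto
  moreover have "0 \<le> p" "r 0 = p"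
    using p assms(4) by (auto simp: r_def zero_ereal_def)
  moreover have "r (p / m) \<le> 0"
    using r_upper[of 0 "p / m"] \<open>0 < m\<close> calculation by simp
  ultimately obtain t where "0 \<le> t" "r t = 0"
    using IVT2'[of r "p / m" 0 0] \<open>0 < m\<close> by auto
  then show ?thesis
    using fin[of t] by (auto simp: zero_ereal_def)
qed


section \<open>Comparison of the BS measure with the pressure measure\<close>

lemma bowen_dist_self:
  assumes "finite F" "F \<noteq> {}"
  shows "bowen_dist \<phi> F x x = 0"
  using assms by (simp add: bowen_dist_def)

lemma dist_le_if_mem_bowen_cball:
  assumes "finite F" "g \<in> F" "y \<in> bowen_cball \<phi> F x \<epsilon>"
  shows "dist (\<phi> g x) (\<phi> g y) \<le> \<epsilon>"
proof -
  have "dist (\<phi> g x) (\<phi> g y) \<le> bowen_dist \<phi> F x y"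
    unfolding bowen_dist_def using assms by (intro Max_ge) auto
  then show ?thesis
    using assms(3) by (simp add: bowen_cball_def)
qed

lemma bdd_above_birkhoff_sum:
  assumes "\<And>x. \<Phi> x \<le> M"
  shows "bdd_above (birkhoff_sum \<phi> F \<Phi> ` A)"
proof (rule bdd_aboveI2)
  fix y
  have "birkhoff_sum \<phi> F \<Phi> y \<le> birkhoff_sum \<phi> F (\<lambda>_. 0) y + M * real (card F)"
    by (rule birkhoff_sum_le_add_const) (simp add: assms)
  then show "birkhoff_sum \<phi> F \<Phi> y \<le> M * real (card F)"
    by (simp add: birkhoff_sum_def)
qed

lemma bsp_measure_antimono_radius:
  assumes "\<And>k. finite (F k) \<and> F k \<noteq> {}" "\<And>x. \<Phi> x \<le> M" "0 \<le> s" "0 \<le> \<epsilon>'" "\<epsilon>' \<le> \<epsilon>"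
  shows "bsp_measure \<phi> F \<Phi> s \<epsilon> H \<le> bsp_measure \<phi> F \<Phi> s \<epsilon>' H"
  unfolding bsp_measure_eq_weighted
proof (rule weighted_packing_measure_mono[OF assms(5)])
  fix k x
  have "x \<in> bowen_cball \<phi> (F k) x \<epsilon>'"
    using assms by (simp add: bowen_cball_def bowen_dist_self)
  then have "(SUP y\<in>bowen_cball \<phi> (F k) x \<epsilon>'. birkhoff_sum \<phi> (F k) \<Phi> y)
      \<le> (SUP y\<in>bowen_cball \<phi> (F k) x \<epsilon>. birkhoff_sum \<phi> (F k) \<Phi> y)"
    by (intro cSUP_subset_mono bdd_above_birkhoff_sum[OF assms(2)]
          bowen_cball_mono_radius assms) auto
  then show "exp (- s * (SUP y\<in>bowen_cball \<phi> (F k) x \<epsilon>. birkhoff_sum \<phi> (F k) \<Phi> y))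
      \<le> exp (- s * (SUP y\<in>bowen_cball \<phi> (F k) x \<epsilon>'. birkhoff_sum \<phi> (F k) \<Phi> y))"
    using assms(3) by (simp add: mult_left_mono)
qed

lemma bsp_dim_eq_SUP:
  assumes "\<And>k. finite (F k) \<and> F k \<noteq> {}" "\<And>x. \<Phi> x \<le> M"
  shows "bsp_dim \<phi> F \<Phi> H = (SUP \<epsilon>\<in>{0<..}. bsp_dim_at \<phi> F \<Phi> \<epsilon> H)"
  unfolding bsp_dim_def
proof (rule Lim_at_right_eq_SUP)
  fix a b :: real assume "0 < a" "a \<le> b"
  then have "bsp_measure \<phi> F \<Phi> s b H \<le> bsp_measure \<phi> F \<Phi> s a H" if "0 < s" for s
    using assms that by (intro bsp_measure_antimono_radius) auto
  then show "bsp_dim_at \<phi> F \<Phi> b H \<le> bsp_dim_at \<phi> F \<Phi> a H"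
    unfolding bsp_dim_at_def by (intro SUP_subset_mono) (auto simp: top_unique, metis top_unique)
qed

text \<open>The supremum over a ball is at least the value at its centre.\<close>

lemma bsp_measure_le_pressure_measure:
  assumes "\<And>k. finite (F k) \<and> F k \<noteq> {}" "\<And>x. \<Phi> x \<le> M" "0 \<le> s" "0 \<le> \<epsilon>"
  shows "bsp_measure \<phi> F \<Phi> s \<epsilon> H \<le> pressure_measure \<phi> F (\<lambda>x. - s * \<Phi> x) 0 \<epsilon> H"
  unfolding bsp_measure_eq_weighted pressure_measure_eq_weighted
proof (rule weighted_packing_measure_mono[OF order_refl])
  fix k x
  have "x \<in> bowen_cball \<phi> (F k) x \<epsilon>"
    using assms by (simp add: bowen_cball_def bowen_dist_self)
  then have "birkhoff_sum \<phi> (F k) \<Phi> x \<le> (SUP y\<in>bowen_cball \<phi> (F k) x \<epsilon>. birkhoff_sum \<phi> (F k) \<Phi> y)"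
    by (intro cSUP_upper bdd_above_birkhoff_sum[OF assms(2)])
  from mult_left_mono[OF this assms(3)]
  show "exp (- s * (SUP y\<in>bowen_cball \<phi> (F k) x \<epsilon>. birkhoff_sum \<phi> (F k) \<Phi> y))
      \<le> exp (- 0 * real (card (F k)) + birkhoff_sum \<phi> (F k) (\<lambda>x. - s * \<Phi> x) x)"
    by (simp add: birkhoff_sum_def sum_negf flip: sum_distrib_left)
qed

text \<open>
  All \<open>g x\<close> and \<open>g y\<close> with \<open>g \<in> F\<close> are \<open>\<epsilon>\<close>-close when \<open>y\<close> lies in the Bowen ball of \<open>x\<close>, so an
  oscillation of \<open>\<Phi>\<close> of at most \<open>\<delta>\<close> at scale \<open>\<epsilon>\<close> accumulates to at most \<open>\<delta> |F|\<close>.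
\<close>

lemma pressure_measure_le_bsp_measure:
  assumes "\<And>k. finite (F k) \<and> F k \<noteq> {}" "0 \<le> s" "0 \<le> \<epsilon>"
    and osc: "\<And>x y. dist x y \<le> \<epsilon> \<Longrightarrow> \<Phi> y \<le> \<Phi> x + \<delta>"
  shows "pressure_measure \<phi> F (\<lambda>x. - s * \<Phi> x) (s * \<delta>) \<epsilon> H \<le> bsp_measure \<phi> F \<Phi> s \<epsilon> H"
  unfolding bsp_measure_eq_weighted pressure_measure_eq_weighted
proof (rule weighted_packing_measure_mono[OF order_refl])
  fix k x
  have "x \<in> bowen_cball \<phi> (F k) x \<epsilon>"
    using assms by (simp add: bowen_cball_def bowen_dist_self)
  moreover have "birkhoff_sum \<phi> (F k) \<Phi> y \<le> birkhoff_sum \<phi> (F k) \<Phi> x + \<delta> * real (card (F k))"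
    if "y \<in> bowen_cball \<phi> (F k) x \<epsilon>" for y
    using assms(1) that by (intro birkhoff_sum_le_add_const osc dist_le_if_mem_bowen_cball) auto
  ultimately have "(SUP y\<in>bowen_cball \<phi> (F k) x \<epsilon>. birkhoff_sum \<phi> (F k) \<Phi> y)
      \<le> birkhoff_sum \<phi> (F k) \<Phi> x + \<delta> * real (card (F k))"
    by (intro cSUP_least) auto
  from mult_left_mono[OF this assms(2)]
  show "exp (- (s * \<delta>) * real (card (F k)) + birkhoff_sum \<phi> (F k) (\<lambda>x. - s * \<Phi> x) x)
      \<le> exp (- s * (SUP y\<in>bowen_cball \<phi> (F k) x \<epsilon>. birkhoff_sum \<phi> (F k) \<Phi> y))"
    by (simp add: birkhoff_sum_def sum_negf algebra_simps flip: sum_distrib_left)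
qed


section \<open>Bowen's equation for the BS packing dimension\<close>

text \<open>
  An infinite BS measure at radius \<open>\<epsilon>\<close> forces the pressure measure with exponent \<open>0\<close> to be infinite
  at the same radius, so the pressure is non-negative.
\<close>

lemma bsp_dim_le_if_pressure_neg:
  assumes "\<And>k. finite (F k) \<and> F k \<noteq> {}" "\<And>x. \<Phi> x \<le> M"
    and neg: "\<And>s. t < s \<Longrightarrow> packing_pressure \<phi> F (\<lambda>x. - s * \<Phi> x) H < 0"
  shows "bsp_dim \<phi> F \<Phi> H \<le> ennreal t"
  unfolding bsp_dim_eq_SUP[OF assms(1,2)] bsp_dim_at_def
proof (intro SUP_least)
  fix \<epsilon> s :: real
  assume \<epsilon>: "\<epsilon> \<in> {0<..}" and s: "s \<in> {s. 0 < s \<and> bsp_measure \<phi> F \<Phi> s \<epsilon> H = \<infinity>}"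
  then have "pressure_measure \<phi> F (\<lambda>x. - s * \<Phi> x) 0 \<epsilon> H = \<infinity>"
    using bsp_measure_le_pressure_measure[where \<phi>=\<phi> and F=F and \<Phi>=\<Phi> and M=M and s=s and \<epsilon>=\<epsilon> and H=H]
      assms(1,2) by (auto simp: top_unique)
  then have "ereal 0 \<le> packing_pressure_at \<phi> F (\<lambda>x. - s * \<Phi> x) \<epsilon> H"
    unfolding packing_pressure_at_def by (intro SUP_upper) simp
  also have "\<dots> \<le> packing_pressure \<phi> F (\<lambda>x. - s * \<Phi> x) H"
    unfolding packing_pressure_eq_SUP by (rule SUP_upper[OF \<epsilon>])
  finally have "s \<le> t"
    using neg[of s] by (force simp: zero_ereal_def)
  then show "ennreal s \<le> ennreal t"
    by (rule ennreal_leI)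
qed

text \<open>
  Both requirements on the radius, small oscillation of \<open>\<Phi>\<close> and pressure at that radius above a
  positive number \<open>r\<close>, persist as the radius shrinks, so they can be met together.
\<close>

lemma bsp_dim_ge_if_pressure_pos:
  assumes "\<And>k. finite (F k) \<and> F k \<noteq> {}" "\<And>x. \<Phi> x \<le> M"
    and "uniformly_continuous_on UNIV \<Phi>" "0 < s"
    and pos: "0 < packing_pressure \<phi> F (\<lambda>x. - s * \<Phi> x) H"
  shows "ennreal s \<le> bsp_dim \<phi> F \<Phi> H"
proof -
  obtain r where r: "0 < r" "ereal r < packing_pressure \<phi> F (\<lambda>x. - s * \<Phi> x) H"
    using ereal_dense2[OF pos] by (auto simp: zero_ereal_def)
  \<comment> \<open>The BS measure dominates the pressure measure with exponent \<open>s * \<delta>\<close>, which is to be \<open>r\<close>.\<close>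
  define \<delta> where "\<delta> = r / s"
  have "0 < \<delta>"
    using r \<open>0 < s\<close> by (simp add: \<delta>_def)
  then obtain \<epsilon>1 where \<epsilon>1: "0 < \<epsilon>1" "\<And>x y. dist x y < \<epsilon>1 \<Longrightarrow> dist (\<Phi> x) (\<Phi> y) < \<delta>"
    using assms(3) unfolding uniformly_continuous_on_def by (metis UNIV_I)
  obtain \<epsilon>2 where \<epsilon>2: "0 < \<epsilon>2" "ereal r < packing_pressure_at \<phi> F (\<lambda>x. - s * \<Phi> x) \<epsilon>2 H"
    using r(2) unfolding packing_pressure_eq_SUP less_SUP_iff by auto
  define \<epsilon> where "\<epsilon> = min (\<epsilon>1 / 2) \<epsilon>2"
  have \<epsilon>: "0 < \<epsilon>" "\<epsilon> < \<epsilon>1" "\<epsilon> \<le> \<epsilon>2"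
    using \<epsilon>1 \<epsilon>2 by (auto simp: \<epsilon>_def)
  have "ereal r < packing_pressure_at \<phi> F (\<lambda>x. - s * \<Phi> x) \<epsilon> H"
    using \<epsilon>2(2) packing_pressure_at_antimono[OF \<epsilon>(3)] by (rule less_le_trans)
  then obtain r' where "r < r'" "pressure_measure \<phi> F (\<lambda>x. - s * \<Phi> x) r' \<epsilon> H = \<infinity>"
    unfolding packing_pressure_at_def less_SUP_iff by auto
  then have "pressure_measure \<phi> F (\<lambda>x. - s * \<Phi> x) r \<epsilon> H = \<infinity>"
    using pressure_measure_le_shift[where \<Psi>="\<lambda>x. - s * \<Phi> x" and \<Psi>'="\<lambda>x. - s * \<Phi> x" and c=0
        and s=r' and s'=r and \<phi>=\<phi> and F=F and \<epsilon>=\<epsilon> and H=H]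
    by (simp add: top_unique)
  moreover have "\<Phi> y \<le> \<Phi> x + \<delta>" if "dist x y \<le> \<epsilon>" for x y
    using \<epsilon>1(2)[of x y] that \<epsilon>(2) by (simp add: dist_real_def abs_less_iff)
  then have "pressure_measure \<phi> F (\<lambda>x. - s * \<Phi> x) (s * \<delta>) \<epsilon> H \<le> bsp_measure \<phi> F \<Phi> s \<epsilon> H"
    using assms(1,4) \<epsilon>(1) by (intro pressure_measure_le_bsp_measure) auto
  ultimately have "bsp_measure \<phi> F \<Phi> s \<epsilon> H = \<infinity>"
    using \<open>0 < s\<close> by (simp add: \<delta>_def top_unique)
  then have "ennreal s \<le> bsp_dim_at \<phi> F \<Phi> \<epsilon> H"
    unfolding bsp_dim_at_def using \<open>0 < s\<close> by (intro SUP_upper) simp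
  also have "\<dots> \<le> bsp_dim \<phi> F \<Phi> H"
    unfolding bsp_dim_eq_SUP[OF assms(1,2)] using \<epsilon>(1) by (intro SUP_upper) simp
  finally show ?thesis .
qed

theorem theorem4p4:
  fixes G :: "('g, 'b) monoid_scheme"
    and \<phi> :: "'g \<Rightarrow> 'x::metric_space \<Rightarrow> 'x"
    and F :: "nat \<Rightarrow> 'g set"
    and H :: "'x set"
    and \<Phi> :: "'x \<Rightarrow> real"
  assumes "compact (UNIV :: 'x set)"
    and "group G" "countable (carrier G)" "infinite (carrier G)" "amenable_group G"
    and "continuous_action G \<phi>"
    and "folner_sequence G F"
    and "incseq (\<lambda>n. card (F n))"
    and "filterlim (\<lambda>n. card (F n)) at_top sequentially"
    and "H \<noteq> {}"
    and "continuous_on UNIV \<Phi>" "\<And>x. 0 < \<Phi> x"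
  shows "(packing_pressure \<phi> F (\<lambda>_. 0) H < \<infinity> \<longrightarrow>
            (\<exists>!t::real. packing_pressure \<phi> F (\<lambda>x. - t * \<Phi> x) H = 0)) \<and>
         (\<forall>t::real. packing_pressure \<phi> F (\<lambda>x. - t * \<Phi> x) H = 0 \<longrightarrow>
            (\<forall>t'::real. packing_pressure \<phi> F (\<lambda>x. - t' * \<Phi> x) H = 0 \<longrightarrow> t' = t) \<and>
            enn2ereal (bsp_dim \<phi> F \<Phi> H) = ereal t)"
proof -
  have folner: "finite (F k) \<and> F k \<noteq> {}" for k
    using assms(7) by (simp add: folner_sequence_def)
  obtain a b where "\<And>x. \<Phi> a \<le> \<Phi> x" "\<And>x. \<Phi> x \<le> \<Phi> b"
    using continuous_attains_inf[OF assms(1) _ assms(11)]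
      continuous_attains_sup[OF assms(1) _ assms(11)] by auto
  then obtain m M where m: "0 < m" "\<And>x. m \<le> \<Phi> x" and M: "\<And>x. \<Phi> x \<le> M"
    using assms(12) by blast
  define P where "P t = packing_pressure \<phi> F (\<lambda>x. - t * \<Phi> x) H" for t :: real
  have upper: "P t' \<le> P t + ereal (- (t' - t) * m)" if "t \<le> t'" for t t'
    unfolding P_def
  proof (rule packing_pressure_le_add_const)
    show "- t' * \<Phi> x \<le> - t * \<Phi> x + - (t' - t) * m" for x
      using mult_left_mono[OF m(2)[of x], of "t' - t"] that by (simp add: algebra_simps)
  qed
  have lower: "P t \<le> P t' + ereal ((t' - t) * M)" if "t \<le> t'" for t t'
    unfolding P_def
  proof (rule packing_pressure_le_add_const)
    show "- t * \<Phi> x \<le> - t' * \<Phi> x + (t' - t) * M" for x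
      using mult_left_mono[OF M[of x], of "t' - t"] that by (simp add: algebra_simps)
  qed
  have P0: "P 0 = packing_pressure \<phi> F (\<lambda>_. 0) H"
    by (simp add: P_def)
  have "0 \<le> P 0"
    unfolding P0 by (rule packing_pressure_zero_nonneg[OF assms(9,10)])
  have unique: "t' = t" if "P t = 0" "P t' = 0" for t t'
    using bounded_slope_root_unique[OF upper m(1) that] .
  have "\<exists>!t. P t = 0" if "P 0 < \<infinity>"
    using bounded_slope_root_exists[OF upper m(1) lower \<open>0 \<le> P 0\<close> that] unique by blast
  moreover have "enn2ereal (bsp_dim \<phi> F \<Phi> H) = ereal t" if t: "P t = 0" for t
  proof -
    have neg: "P s < 0" if "t < s" for s
    proof -
      have "P s \<le> ereal (- (s - t) * m)"
        using upper[of t s] t that by simp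
      also have "\<dots> < 0"
        using that m(1) by (simp add: zero_ereal_def mult_neg_pos)
      finally show ?thesis .
    qed
    have pos: "0 < P s" if "s < t" for s
    proof -
      have "0 \<le> P s + ereal (- (t - s) * m)"
        using upper[of s t] t that by simp
      moreover have "0 < (t - s) * m"
        using that m(1) by simp
      ultimately show ?thesis
        by (cases "P s") (auto simp: zero_ereal_def algebra_simps)
    qed
    have "0 \<le> t"
      using neg[of 0] \<open>0 \<le> P 0\<close> by (meson leD not_le_imp_less)
    have "bsp_dim \<phi> F \<Phi> H \<le> ennreal t"
      using neg unfolding P_def by (intro bsp_dim_le_if_pressure_neg[OF folner M])
    moreover have "ennreal t \<le> bsp_dim \<phi> F \<Phi> H"
    proof (rule dense_le)
      fix z assume "z < ennreal t"
      then obtain s where s: "0 \<le> s" "z = ennreal s" "s < t"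
        by (cases z) (auto simp: ennreal_less_iff)
      show "z \<le> bsp_dim \<phi> F \<Phi> H"
      proof (cases "s = 0")
        case False
        then show ?thesis
          using s pos[OF s(3)] compact_uniformly_continuous[OF assms(11,1)]
          unfolding P_def by (auto intro!: bsp_dim_ge_if_pressure_pos[OF folner M])
      qed (use s in simp)
    qed
    ultimately show ?thesis
      using \<open>0 \<le> t\<close> by (simp add: antisym enn2ereal_ennreal)
  qed
  ultimately show ?thesis
    using unique unfolding P0 unfolding P_def by blast
qed

end
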